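(* The generalized Bernoulli polynomials have the following special values, for integers $m$ in the indicated ranges. For even order: $$B^{(2m+2)}_{2m}(m+1)=\frac{(-1)^m (m!)^2}{2m+1}\quad(m\ge0),$$ $$B^{(2m+2)}_{2m-2}(m+1)=\frac{(-1)^{m+1}(2m-2)!}{(2m+1)!}\,(m!)^2\, 6\, H_{m}^{(2)}\quad(m\ge1),$$ $$B^{(2m+2)}_{2m-4}(m+1)=\frac{(-1)^{m}\,5!\,(2m-4)!}{2(2m+1)!}\,(m!)^2\left(\big(H_m^{(2)}\big)^2-H_m^{(4)}\right)\quad(m\ge2),$$ $$B^{(2m+2)}_{2m-6}(m+1)=\frac{(-1)^{m+1}\,7!\,(2m-6)!}{6(2m+1)!}\,(m!)^2\left(\big(H_m^{(2)}\big)^3-3H_m^{(2)}H_m^{(4)}+2H_m^{(6)}\right)\quad(m\ge3).$$ For odd order: $$B_0^{(1)}(0)=1,\qquad B^{(2m+1)}_{2m}(m)=0\quad(m\ge1),$$ $$B^{(2m+1)}_{2m-2}(m)=\frac{(-1)^{m+1}\,2\,(2m-2)!}{(2m)!}\,((m-1)!)^2\quad(m\ge1),$$ $$B^{(2m+1)}_{2m-4}(m)=\frac{(-1)^{m}\,4!\,(2m-4)!}{(2m)!}\,((m-1)!)^2\, H_{m-1}^{(2)}\quad(m\ge2),$$ $$B^{(2m+1)}_{2m-6}(m)=\frac{(-1)^{m+1}\,6!\,(2m-6)!}{2(2m)!}\,((m-1)!)^2\left(\big(H_{m-1}^{(2)}\big)^2-H_{m-1}^{(4)}\right)\quad(m\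ge3).$$
   Context: $H_m^{(r)}=\sum_{j=1}^m j^{-r}$ is the harmonic number of order $r$ (with $H_0^{(r)}=0$). For an integer $r\ge 0$ and real $t$, the generalized Bernoulli polynomials $B_n^{(r)}(t)$ are defined by $\frac{x^r}{(e^x-1)^r}e^{tx}=\sum_{n=0}^\infty \frac{B_n^{(r)}(t)}{n!}x^n$ for $|x|<2\pi$. *)

theory Defs
  imports "HOL-Complex_Analysis.Complex_Analysis"
begin

definition gen_harmonic :: "nat \<Rightarrow> nat \<Rightarrow> real" where
  "gen_harmonic r m = (\<Sum>j=1..m. 1 / real j ^ r)"

text \<open>
  The generating function \<open>x^r e^(t x) / (e^x - 1)^r\<close> has a removable singularity at
  \<open>x = 0\<close>, where HOL's total division gives \<open>0\<close> instead of \<open>1\<close> when \<open>r > 0\<close>, so the expansion is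
  required only for \<open>0 < \<bar>x\<bar> < 2 \<pi>\<close>; this already determines all coefficients.
\<close>

definition gen_bernpoly_seq :: "nat \<Rightarrow> real \<Rightarrow> (nat \<Rightarrow> real) \<Rightarrow> bool" where
  "gen_bernpoly_seq r t b \<longleftrightarrow>
     (\<forall>x::real. x \<noteq> 0 \<and> \<bar>x\<bar> < 2 * pi \<longrightarrow>
        (\<lambda>n. b n / fact n * x ^ n) sums (x ^ r / (exp x - 1) ^ r * exp (t * x)))"

text \<open>\<open>gen_bernpoly r n t\<close> is the value $B_n^{(r)}(t)$.\<close>

definition gen_bernpoly :: "nat \<Rightarrow> nat \<Rightarrow> real \<Rightarrow> real" where
  "gen_bernpoly r n t = (THE b. gen_bernpoly_seq r t b) n"

text \<open>The definite description is justified by existence and uniqueness of the expansion.\<close>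

lemma powser_punctured_eq_0:
  fixes c :: "nat \<Rightarrow> real"
  assumes s: "0 < s"
    and sm: "\<And>x. x \<noteq> 0 \<Longrightarrow> \<bar>x\<bar> < s \<Longrightarrow> (\<lambda>n. c n * x ^ n) sums 0"
  shows "c n = 0"
  using sm
proof (induction n arbitrary: c)
  case 0
  have "((\<lambda>_. 0) \<longlongrightarrow> c 0) (at (0::real))"
    by (rule powser_limit_0_strong[OF s]) (use 0 in auto)
  then show ?case
    by (simp add: tendsto_const_iff)
next
  case (Suc n)
  have "((\<lambda>_. 0) \<longlongrightarrow> c 0) (at (0::real))"
    by (rule powser_limit_0_strong[OF s]) (use Suc.prems in auto)
  then have c0: "c 0 = 0"
    by (simp add: tendsto_const_iff)
  have "(\<lambda>k. c (Suc k) * x ^ k) sums 0" if "x \<noteq> 0" "\<bar>x\<bar> < s" for x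
  proof -
    have "(\<lambda>k. c (Suc k) * x ^ Suc k) sums 0"
      using Suc.prems[OF that] c0 by (subst sums_Suc_iff) simp
    from sums_mult[OF this, of "1 / x"] show ?thesis
      using that by (simp add: field_simps)
  qed
  then show ?case
    by (rule Suc.IH)
qed

lemma gen_bernpoly_seq_exists: "\<exists>b. gen_bernpoly_seq r t b"
proof -
  define g :: "complex \<Rightarrow> complex" where "g = (\<lambda>z. if z = 0 then 1 else z / (exp z - 1))"
  define F where "F = (\<lambda>z. g z ^ r * exp (of_real t * z))"
  have nz: "exp z \<noteq> 1" if "z \<in> ball 0 (2 * pi)" "z \<noteq> 0" for z :: complex
  proof
    assume "exp z = 1"
    then obtain n :: int where n: "Re z = 0" "Im z = of_int (2 * n) * pi"
      by (auto simp: exp_eq_1)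
    then have "n \<noteq> 0"
      using that(2) by (auto simp: complex_eq_iff)
    then have "1 * (2 * pi) \<le> \<bar>real_of_int n\<bar> * (2 * pi)"
      by (intro mult_right_mono) auto
    also have "\<dots> = \<bar>Im z\<bar>"
      using n(2) by (simp add: abs_mult)
    also have "\<dots> \<le> norm z"
      by (rule abs_Im_le_cmod)
    finally show False
      using that(1) by simp
  qed
  have "((\<lambda>z::complex. (exp z - 1) / z) \<longlongrightarrow> 1) (at 0)"
    using DERIV_exp[of "0::complex"] by (simp add: has_field_derivative_def[symmetric] DERIV_def)
  from tendsto_inverse[OF this] have "((\<lambda>z::complex. z / (exp z - 1)) \<longlongrightarrow> 1) (at 0)"
    by simp
  then have "(g \<longlongrightarrow> 1) (at 0)"
    unfolding g_def by (rule Lim_transform_eventually) (auto simp: eventually_at_filter)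
  then have lim: "(g \<longlongrightarrow> g z) (at z within ball 0 (2 * pi))" if "z \<in> {0}" for z
    using that by (auto simp: g_def intro: tendsto_within_subset)
  have "(\<lambda>z. z / (exp z - 1)) holomorphic_on ball 0 (2 * pi) - {0}"
    by (intro holomorphic_intros) (use nz in auto)
  then have holg: "g holomorphic_on ball 0 (2 * pi) - {0}"
    by (rule holomorphic_transform) (auto simp: g_def)
  have "g holomorphic_on ball 0 (2 * pi)"
    by (rule no_isolated_singularity'[OF lim holg]) simp_all
  then have holF: "F holomorphic_on ball 0 (2 * pi)"
    unfolding F_def by (intro holomorphic_intros)
  define b where "b = (\<lambda>n. Re ((deriv ^^ n) F 0))"
  have "(\<lambda>n. b n / fact n * x ^ n) sums (x ^ r / (exp x - 1) ^ r * exp (t * x))"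
    if x: "x \<noteq> 0" "\<bar>x\<bar> < 2 * pi" for x :: real
  proof -
    have "(\<lambda>n. (deriv ^^ n) F 0 / fact n * (of_real x - 0) ^ n) sums F (of_real x)"
      by (rule holomorphic_power_series[OF holF]) (use x in auto)
    then have "(\<lambda>n. Re ((deriv ^^ n) F 0 / fact n * of_real x ^ n)) sums Re (F (of_real x))"
      by (intro sums_Re) simp
    moreover have "Re ((deriv ^^ n) F 0 / fact n * of_real x ^ n) = b n / fact n * x ^ n" for n
    proof -
      have "(deriv ^^ n) F 0 / fact n * of_real x ^ n = of_real (x ^ n / fact n) * (deriv ^^ n) F 0"
        by simp
      then show ?thesis
        by (simp add: b_def del: of_real_divide of_real_power)
    qed
    moreover have "F (of_real x) = of_real (x ^ r / (exp x - 1) ^ r * exp (t * x))"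
      using x by (simp add: F_def g_def power_divide exp_of_real[symmetric])
    ultimately show ?thesis
      by simp
  qed
  then show ?thesis
    unfolding gen_bernpoly_seq_def by blast
qed

lemma gen_bernpoly_seq_unique:
  assumes "gen_bernpoly_seq r t b" "gen_bernpoly_seq r t b'"
  shows "b = b'"
proof
  fix n
  have "(\<lambda>n. (b n - b' n) / fact n * x ^ n) sums 0" if "x \<noteq> 0" "\<bar>x\<bar> < 2 * pi" for x
  proof -
    have "(\<lambda>n. b n / fact n * x ^ n) sums (x ^ r / (exp x - 1) ^ r * exp (t * x))"
      and "(\<lambda>n. b' n / fact n * x ^ n) sums (x ^ r / (exp x - 1) ^ r * exp (t * x))"
      using assms that unfolding gen_bernpoly_seq_def by blast+
    from sums_diff[OF this] show ?thesis
      by (simp add: diff_divide_distrib left_diff_distrib)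
  qed
  then have "(b n - b' n) / fact n = 0"
    by (intro powser_punctured_eq_0[of "2 * pi"]) auto
  then show "b n = b' n"
    by simp
qed

lemma gen_bernpoly_sums:
  assumes "x \<noteq> 0" "\<bar>x\<bar> < 2 * pi"
  shows "(\<lambda>n. gen_bernpoly r n t / fact n * x ^ n) sums (x ^ r / (exp x - 1) ^ r * exp (t * x))"
proof -
  have "gen_bernpoly_seq r t (THE b. gen_bernpoly_seq r t b)"
    using gen_bernpoly_seq_exists gen_bernpoly_seq_unique by (metis (no_types, lifting) theI)
  with assms show ?thesis
    unfolding gen_bernpoly_def gen_bernpoly_seq_def by blast
qed

end

theory Submission
  imports Defs
begin

text \<open>
  Write \<open>B(x) = x / (e^x - 1)\<close>, so that \<open>B_n^{(r)}(t) / n!\<close> is the coefficient of \<open>x^n\<close> in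
  \<open>B(x)^r e^{t x}\<close>. The special values all lie just below the diagonal \<open>r = n + 1\<close>, and on this
  diagonal the polynomial factors completely:
  \<open>B_n^{(n+1)}(t) = (t - 1) (t - 2) \<dots> (t - n)\<close>. The reason is the differential
  equation \<open>x B' = B - x B - B^2\<close>, which expresses \<open>B^{r+1} e^{t x}\<close> through \<open>F = B^r e^{t x}\<close>, \<open>x F\<close>
  and \<open>x F'\<close>. In degree \<open>n = r\<close> the contributions of \<open>r F\<close> and of \<open>x F'\<close> cancel, and only the
  factor \<open>t - n\<close> times the previous diagonal coefficient is left (\<open>gen_bern_fps_diagonal\<close>).

  Replacing \<open>t\<close> by \<open>t + s\<close> multiplies the generating function by \<open>e^{s x}\<close>. Hence
  \<open>B_{n-j}^{(n+1)}(t)\<close> is, up to the factor \<open>1 / (n choose j)\<close>, the coefficient of \<open>s^j\<close> in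
  \<open>\<Prod>_{i=1}^n (t + s - i)\<close> (\<open>gen_bernpoly_below_order\<close>).

  At the centre \<open>t = m + 1\<close> with \<open>n = 2 m + 1\<close> the roots of this product are symmetric around \<open>0\<close>
  and it equals \<open>s \<Prod>_{k=1}^m (s^2 - k^2)\<close>. At \<open>t = m\<close> with \<open>n = 2 m\<close> it equals
  \<open>s (s - m) \<Prod>_{k=1}^{m-1} (s^2 - k^2)\<close>. The coefficients of \<open>\<Prod>_k (s^2 - k^2)\<close> are, up to the
  factor \<open>\<plusminus>(m!)^2\<close>, elementary symmetric polynomials in the numbers \<open>1 / k^2\<close>, and Newton's identities
  turn these into the power sums \<open>H_m^{(2)}\<close>, \<open>H_m^{(4)}\<close>, \<open>H_m^{(6)}\<close>
  (\<open>coeff_squares_poly\<close>).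
\<close>

unbundle no vec_syntax

section \<open>The generating function as a formal power series\<close>

definition gen_bern_fps :: "nat \<Rightarrow> real \<Rightarrow> real fps" where
  "gen_bern_fps r t = Abs_fps (\<lambda>n. gen_bernpoly r n t / fact n)"

lemma gen_bern_fps_nth: "gen_bern_fps r t $ n = gen_bernpoly r n t / fact n"
  by (simp add: gen_bern_fps_def)

lemma fps_conv_radius_gen_bern_fps: "ereal (2 * pi) \<le> fps_conv_radius (gen_bern_fps r t)"
  unfolding fps_conv_radius_def
proof (rule conv_radius_geI_ex')
  fix x :: real
  assume "0 < x" "ereal x < ereal (2 * pi)"
  then show "summable (\<lambda>n. gen_bern_fps r t $ n * of_real x ^ n)"
    using gen_bernpoly_sums[of x r t] by (auto simp: gen_bern_fps_nth sums_iff)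
qed

lemma fps_eq_if_eval_fps_eq_punctured:
  fixes f g :: "real fps" and s :: real
  assumes "0 < s" "s \<le> fps_conv_radius f" "s \<le> fps_conv_radius g"
    and eq: "\<And>x. x \<noteq> 0 \<Longrightarrow> \<bar>x\<bar> < s \<Longrightarrow> eval_fps f x = eval_fps g x"
  shows "f = g"
proof (rule fps_ext)
  fix n
  have "f $ n - g $ n = 0"
  proof (rule powser_punctured_eq_0[OF \<open>0 < s\<close>])
    fix x :: real
    assume x: "x \<noteq> 0" "\<bar>x\<bar> < s"
    then have "ereal (norm x) < fps_conv_radius f" "ereal (norm x) < fps_conv_radius g"
      using less_le_trans[of "ereal (norm x)" "ereal s"] assms(2,3) by simp_all
    from sums_diff[OF this[THEN sums_eval_fps]] show "(\<lambda>n. (f $ n - g $ n) * x ^ n) sums 0"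
      using eq[OF x] by (simp add: left_diff_distrib)
  qed
  then show "f $ n = g $ n"
    by simp
qed

text \<open>
  Multiplying out the denominator makes both sides convergent power series, so the analytic
  expansion, valid away from \<open>0\<close>, becomes an identity of formal power series.
\<close>

lemma gen_bern_fps_mult_exp_power:
  "gen_bern_fps r t * (fps_exp 1 - 1) ^ r = fps_X ^ r * fps_exp t"
proof (rule fps_eq_if_eval_fps_eq_punctured)
  have radE: "fps_conv_radius (fps_exp 1 - 1 :: real fps) = \<infinity>"
    using fps_conv_radius_diff[of "fps_exp 1 :: real fps" 1] by simp
  have radEr: "fps_conv_radius ((fps_exp 1 - 1) ^ r :: real fps) = \<infinity>"
    using fps_conv_radius_power[of "fps_exp 1 - 1 :: real fps" r] by (simp add: radE)
  show "ereal (2 * pi) \<le> fps_conv_radius (gen_bern_fps r t * (fps_exp 1 - 1) ^ r)"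
    using fps_conv_radius_mult[of "gen_bern_fps r t" "(fps_exp 1 - 1) ^ r"]
      fps_conv_radius_gen_bern_fps[of r t] by (simp add: radEr)
  show "ereal (2 * pi) \<le> fps_conv_radius (fps_X ^ r * fps_exp t)"
    using fps_conv_radius_mult[of "fps_X ^ r" "fps_exp t"] by simp
  fix x :: real
  assume x: "x \<noteq> 0" "\<bar>x\<bar> < 2 * pi"
  then have rad: "ereal (norm x) < fps_conv_radius (gen_bern_fps r t)"
    using less_le_trans[OF _ fps_conv_radius_gen_bern_fps[of r t]] by simp
  have "eval_fps (gen_bern_fps r t) x = x ^ r / (exp x - 1) ^ r * exp (t * x)"
    using gen_bernpoly_sums[OF x, of r t] by (simp add: eval_fps_def gen_bern_fps_nth sums_iff)
  moreover have "eval_fps (fps_exp 1 - 1) x = exp x - 1"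
    by (subst eval_fps_diff) auto
  ultimately show "eval_fps (gen_bern_fps r t * (fps_exp 1 - 1) ^ r) x
      = eval_fps (fps_X ^ r * fps_exp t) x"
    using x rad by (simp add: eval_fps_mult eval_fps_power radE radEr)
qed (use pi_gt_zero in simp)

lemma fps_exp_minus_1_nonzero: "fps_exp 1 - 1 \<noteq> (0 :: real fps)"
proof
  assume "fps_exp 1 - 1 = (0 :: real fps)"
  then have "(fps_exp 1 - 1) $ 1 = (0 :: real fps) $ 1"
    by simp
  then show False
    by simp
qed

definition bern_fps :: "real fps" where
  "bern_fps = gen_bern_fps 1 0"

lemma bern_fps_mult_exp: "bern_fps * (fps_exp 1 - 1) = fps_X"
  using gen_bern_fps_mult_exp_power[of 1 0] by (simp add: bern_fps_def)

text \<open>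
  The algebra below starts here: the order is an exponent, so increasing it by one is
  multiplication by \<^const>\<open>bern_fps\<close>.
\<close>

lemma gen_bern_fps_eq: "gen_bern_fps r t = bern_fps ^ r * fps_exp t"
proof -
  have "gen_bern_fps r t * (fps_exp 1 - 1) ^ r = bern_fps ^ r * fps_exp t * (fps_exp 1 - 1) ^ r"
    by (simp add: gen_bern_fps_mult_exp_power bern_fps_mult_exp[symmetric] power_mult_distrib)
  then show ?thesis
    using fps_exp_minus_1_nonzero by simp
qed

text \<open>
  Since \<open>B (e^x - 1) = x\<close> and \<open>e^x - 1\<close> has derivative \<open>(e^x - 1) + 1\<close>, differentiation gives
  \<open>B' (e^x - 1) = 1 - B e^x\<close>. Multiplying this by \<open>x\<close> and writing \<open>x\<close> as \<open>B (e^x - 1)\<close> throughout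
  the right-hand side makes \<open>e^x - 1\<close> a common factor, which cancels.
\<close>

lemma bern_fps_deriv: "fps_X * fps_deriv bern_fps = bern_fps * (1 - fps_X - bern_fps)"
proof -
  let ?E = "fps_exp 1 - 1 :: real fps"
  have "fps_deriv (bern_fps * ?E) = 1"
    by (simp only: bern_fps_mult_exp fps_deriv_fps_X)
  then have "fps_deriv bern_fps * ?E = 1 - bern_fps * (?E + 1)"
    by (simp add: algebra_simps)
  then have "fps_X * fps_deriv bern_fps * ?E = fps_X * (1 - bern_fps * (?E + 1))"
    by (simp only: mult.assoc)
  also have "\<dots> = bern_fps * (1 - fps_X - bern_fps) * ?E"
    unfolding bern_fps_mult_exp[symmetric] by (simp add: algebra_simps)
  finally show ?thesis
    using fps_exp_minus_1_nonzero by simp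
qed

section \<open>The diagonal values\<close>

text \<open>
  This is the differential equation of \<open>B\<close> carried over to \<open>F = B^r e^{t x}\<close>:
  \<open>x F' = r (1 - x - B) F + t x F\<close>, solved for the term \<open>r B F\<close>.
\<close>

lemma gen_bern_fps_Suc:
  "of_nat r * gen_bern_fps (Suc r) t =
     of_nat r * gen_bern_fps r t + fps_const (t - real r) * (fps_X * gen_bern_fps r t)
       - fps_X * fps_deriv (gen_bern_fps r t)"
proof (cases r)
  case 0
  then show ?thesis
    by (simp add: gen_bern_fps_eq algebra_simps)
next
  case (Suc k)
  have "fps_deriv (bern_fps ^ r) = of_nat r * fps_deriv bern_fps * bern_fps ^ k"
    by (simp only: Suc fps_deriv_power' diff_Suc_1)
  then have "fps_X * fps_deriv (gen_bern_fps r t) =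
      of_nat r * (fps_X * fps_deriv bern_fps) * bern_fps ^ k * fps_exp t
        + fps_const t * fps_X * bern_fps ^ r * fps_exp t"
    by (simp add: gen_bern_fps_eq algebra_simps)
  then show ?thesis
    unfolding bern_fps_deriv
    by (simp add: gen_bern_fps_eq Suc algebra_simps fps_of_nat[symmetric] del: of_nat_Suc
          flip: fps_const_sub)
qed

lemma gen_bern_fps_diagonal: "gen_bern_fps (Suc n) t $ n = (\<Prod>i=1..n. t - real i) / fact n"
proof (induction n)
  case 0
  have "(bern_fps * (fps_exp 1 - 1)) $ 1 = bern_fps $ 0"
    by (simp add: fps_mult_nth)
  then have "bern_fps $ 0 = 1"
    unfolding bern_fps_mult_exp by simp
  then show ?case
    by (simp add: gen_bern_fps_eq)
next
  case (Suc n)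
  let ?r = "Suc n"
  have "(of_nat ?r * gen_bern_fps (Suc ?r) t) $ ?r = (t - real ?r) * gen_bern_fps ?r t $ n"
    \<comment> \<open>The operator \<open>F \<mapsto> x F'\<close> multiplies the coefficient of \<open>x^r\<close> by \<open>r\<close> and so cancels \<open>r F\<close>
      there.\<close>
    unfolding gen_bern_fps_Suc by (simp add: fps_of_nat[symmetric] del: of_nat_Suc)
  then have "real ?r * gen_bern_fps (Suc ?r) t $ ?r = (t - real ?r) * gen_bern_fps ?r t $ n"
    by (simp add: fps_of_nat[symmetric] del: of_nat_Suc)
  then have "gen_bern_fps (Suc ?r) t $ ?r = (t - real ?r) * gen_bern_fps ?r t $ n / real ?r"
    by (simp add: field_simps del: of_nat_Suc)
  then show ?case
    by (simp add: Suc.IH mult_ac del: of_nat_Suc)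
qed

text \<open>
  The coefficient of \<open>x^n\<close> in \<open>B^{n+1} e^{(t+s) x}\<close> can be read in two ways: it is a diagonal value
  at \<open>t + s\<close>, and by \<open>e^{(t+s) x} = e^{s x} e^{t x}\<close> it is a polynomial in \<open>s\<close> with coefficients
  \<open>B_{n-j}^{(n+1)}(t) / ((n-j)! j!)\<close>. The product is described by an arbitrary polynomial \<open>P\<close>, so that
  any convenient factorization of it can be used.
\<close>

lemma gen_bernpoly_below_order:
  assumes "j \<le> n" and P: "\<And>s. poly P s = (\<Prod>i=1..n. t + s - real i)"
  shows "gen_bernpoly (Suc n) (n - j) t = fact (n - j) * fact j / fact n * coeff P j"
proof -
  define Q where "Q = (\<Sum>k\<le>n. monom (gen_bern_fps (Suc n) t $ (n - k) / fact k) k)"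
  have "poly (smult (fact n) Q) s = poly P s" for s
  proof -
    have "gen_bern_fps (Suc n) (t + s) = fps_exp s * gen_bern_fps (Suc n) t"
      by (simp add: gen_bern_fps_eq fps_exp_add_mult mult_ac)
    then have "poly Q s = gen_bern_fps (Suc n) (t + s) $ n"
      by (simp add: Q_def fps_mult_nth poly_sum poly_monom atLeast0AtMost mult_ac)
    then show ?thesis
      by (simp add: P gen_bern_fps_diagonal)
  qed
  then have "smult (fact n) Q = P"
    by (simp flip: poly_eq_poly_eq_iff add: fun_eq_iff)
  moreover have "coeff Q j = gen_bern_fps (Suc n) t $ (n - j) / fact j"
    using \<open>j \<le> n\<close> by (simp add: Q_def coeff_sum)
  ultimately show ?thesis
    by (auto simp: gen_bern_fps_nth)
qed

section \<open>Products with symmetric roots and their coefficients\<close>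

lemma prod_symmetric:
  "(\<Prod>i=1..2*m+1. s + (real m + 1) - real i) = s * (\<Prod>k=1..m. s\<^sup>2 - (real k)\<^sup>2)"
proof (induction m)
  case (Suc m)
  \<comment> \<open>Passing from \<open>m\<close> to \<open>m + 1\<close> adds one root at each end, namely \<open>m + 1\<close> and \<open>- (m + 1)\<close>.\<close>
  have split: "prod f {1..Suc (Suc N)} = prod f {Suc 1..Suc N} * (f (Suc (Suc N)) * f 1)"
    for f :: "nat \<Rightarrow> real" and N
    by (simp add: prod.atLeast_Suc_atMost mult_ac)
  have "(\<Prod>i=1..2 * Suc m + 1. s + (real (Suc m) + 1) - real i)
      = (\<Prod>i=1..Suc (Suc (2*m+1)). s + (real m + 2) - real i)"
    by (simp add: add_ac)
  also have "\<dots> = (\<Prod>i=Suc 1..Suc (2*m+1). s + (real m + 2) - real i)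
      * (s\<^sup>2 - (real (Suc m))\<^sup>2)"
    unfolding split by (rule arg_cong[where f = "(*) _"]) (simp add: algebra_simps power2_eq_square)
  also have "(\<Prod>i=Suc 1..Suc (2*m+1). s + (real m + 2) - real i)
      = (\<Prod>i=1..2*m+1. s + (real m + 1) - real i)"
    by (subst prod.shift_bounds_cl_Suc_ivl) (simp add: algebra_simps)
  finally show ?case
    by (simp only: Suc.IH) simp
qed simp

definition squares_poly :: "nat \<Rightarrow> real poly" where
  "squares_poly m = (\<Prod>k=1..m. [:- ((real k)\<^sup>2), 1:])"

definition central_poly :: "nat \<Rightarrow> real poly" where
  "central_poly m = pcompose (squares_poly m) [:0, 0, 1:]"

lemma poly_central_poly: "poly (central_poly m) s = (\<Prod>k=1..m. s\<^sup>2 - (real k)\<^sup>2)"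
  by (simp add: central_poly_def squares_poly_def poly_pcompose poly_prod power2_eq_square)

lemma coeff_pcompose_square:
  fixes p :: "'a :: comm_ring_1 poly"
  shows "coeff (pcompose p [:0, 0, 1:]) n = (if even n then coeff p (n div 2) else 0)"
proof (induction p arbitrary: n)
  case (pCons a p)
  have step: "coeff (pcompose (pCons a p) [:0, 0, 1:]) n
      = (case n of 0 \<Rightarrow> a | Suc 0 \<Rightarrow> 0 | Suc (Suc k) \<Rightarrow> coeff (pcompose p [:0, 0, 1:]) k)"
    by (simp add: pcompose_pCons coeff_pCons split: nat.split)
  show ?case
  proof (cases n)
    case (Suc l)
    with step show ?thesis
      by (cases l) (simp_all add: pCons.IH)
  qed (simp add: step)
qed simp

text \<open>
  These are Newton's identities for the first elementary symmetric polynomials, proved by adding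
  one factor at a time. Keeping the numerical factors \<open>2 = 2!\<close> and \<open>6 = 3!\<close> on the left avoids
  division.
\<close>

lemma coeff_prod_one_minus:
  fixes c :: "'b \<Rightarrow> 'a :: comm_ring_1"
  assumes "finite A"
  defines "p r \<equiv> (\<Sum>k\<in>A. c k ^ r)"
  defines "F \<equiv> (\<Prod>k\<in>A. [:1, - c k:])"
  shows "coeff F 0 = 1" "coeff F 1 = - p 1" "2 * coeff F 2 = p 1 ^ 2 - p 2"
    "6 * coeff F 3 = - (p 1 ^ 3 - 3 * p 1 * p 2 + 2 * p 3)"
proof -
  have "coeff F 0 = 1 \<and> coeff F 1 = - p 1 \<and> 2 * coeff F 2 = p 1 ^ 2 - p 2
      \<and> 6 * coeff F 3 = - (p 1 ^ 3 - 3 * p 1 * p 2 + 2 * p 3)"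
    unfolding p_def F_def using assms(1)
  proof (induction A)
    case (insert x A)
    let ?G = "\<Prod>k\<in>A. [:1, - c k:]"
    have G: "coeff (\<Prod>k\<in>insert x A. [:1, - c k:]) (Suc n) = coeff ?G (Suc n) - c x * coeff ?G n"
      "coeff (\<Prod>k\<in>insert x A. [:1, - c k:]) 0 = coeff ?G 0" for n
      using insert.hyps by simp_all
    have "2 * (coeff ?G 2 - c x * coeff ?G 1) = 2 * coeff ?G 2 - 2 * c x * coeff ?G 1"
      "6 * (coeff ?G 3 - c x * coeff ?G 2) = 6 * coeff ?G 3 - 3 * c x * (2 * coeff ?G 2)"
      by (simp_all add: algebra_simps)
    with insert.IH G(1)[of 0] G(1)[of 1] G(1)[of 2] G(2) show ?case
      using insert.hyps
      by (simp add: eval_nat_numeral) (simp add: algebra_simps)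
  qed simp
  then show "coeff F 0 = 1" "coeff F 1 = - p 1" "2 * coeff F 2 = p 1 ^ 2 - p 2"
    "6 * coeff F 3 = - (p 1 ^ 3 - 3 * p 1 * p 2 + 2 * p 3)"
    by blast+
qed

text \<open>
  Dividing each factor by its constant term, \<open>y - k^2 = - k^2 (1 - y / k^2)\<close>, reduces this to
  Newton's identities for the numbers \<open>1 / k^2\<close>, whose power sums are harmonic numbers of even
  order.
\<close>

lemma coeff_squares_poly:
  defines "c \<equiv> \<lambda>m. (-1) ^ m * (fact m)\<^sup>2 :: real"
  shows "coeff (squares_poly m) 0 = c m"
    "coeff (squares_poly m) 1 = - c m * gen_harmonic 2 m"
    "coeff (squares_poly m) 2 = c m * ((gen_harmonic 2 m)\<^sup>2 - gen_harmonic 4 m) / 2"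
    "coeff (squares_poly m) 3 = - c m * ((gen_harmonic 2 m) ^ 3
       - 3 * gen_harmonic 2 m * gen_harmonic 4 m + 2 * gen_harmonic 6 m) / 6"
proof -
  let ?F = "\<Prod>k=1..m. [:1, - (1 / (real k)\<^sup>2):]"
  have "squares_poly m = (\<Prod>k=1..m. smult (- ((real k)\<^sup>2)) [:1, - (1 / (real k)\<^sup>2):])"
    unfolding squares_poly_def by (intro prod.cong) auto
  also have "\<dots> = smult (\<Prod>k=1..m. - ((real k)\<^sup>2)) ?F"
    by (rule prod_smult)
  also have "(\<Prod>k=1..m. - ((real k)\<^sup>2)) = c m"
    unfolding c_def by (induction m) (simp_all add: power_mult_distrib mult_ac)
  finally have squares: "squares_poly m = smult (c m) ?F" .
  have power_sum: "(\<Sum>k=1..m. (1 / (real k)\<^sup>2) ^ r) = gen_harmonic (2 * r) m" for r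
    by (simp add: gen_harmonic_def power_divide power_mult)
  have "coeff ?F 0 = 1" "coeff ?F 1 = - gen_harmonic 2 m"
    "2 * coeff ?F 2 = (gen_harmonic 2 m)\<^sup>2 - gen_harmonic 4 m"
    "6 * coeff ?F 3 = - ((gen_harmonic 2 m) ^ 3
       - 3 * gen_harmonic 2 m * gen_harmonic 4 m + 2 * gen_harmonic 6 m)"
    using coeff_prod_one_minus[of "{1..m}" "\<lambda>k. 1 / (real k)\<^sup>2"]
    unfolding power_sum by simp_all
  then have newton: "coeff ?F 0 = 1" "coeff ?F 1 = - gen_harmonic 2 m"
    "coeff ?F 2 = ((gen_harmonic 2 m)\<^sup>2 - gen_harmonic 4 m) / 2"
    "coeff ?F 3 = - ((gen_harmonic 2 m) ^ 3
       - 3 * gen_harmonic 2 m * gen_harmonic 4 m + 2 * gen_harmonic 6 m) / 6"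
    by (simp_all add: field_simps)
  show "coeff (squares_poly m) 0 = c m"
    "coeff (squares_poly m) 1 = - c m * gen_harmonic 2 m"
    "coeff (squares_poly m) 2 = c m * ((gen_harmonic 2 m)\<^sup>2 - gen_harmonic 4 m) / 2"
    "coeff (squares_poly m) 3 = - c m * ((gen_harmonic 2 m) ^ 3
       - 3 * gen_harmonic 2 m * gen_harmonic 4 m + 2 * gen_harmonic 6 m) / 6"
    unfolding squares coeff_smult newton by (simp_all add: algebra_simps)
qed

section \<open>Values near the centre of symmetry\<close>

lemma gen_bernpoly_even_order:
  assumes "i \<le> m"
  shows "gen_bernpoly (2*m+2) (2*m - 2*i) (real m + 1)
    = fact (2*m - 2*i) * fact (2*i+1) / fact (2*m+1) * coeff (squares_poly m) i"
proof -
  have "gen_bernpoly (Suc (2*m+1)) (2*m+1 - (2*i+1)) (real m + 1)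
    = fact (2*m+1 - (2*i+1)) * fact (2*i+1) / fact (2*m+1)
        * coeff (pCons 0 (central_poly m)) (2*i+1)"
  proof (rule gen_bernpoly_below_order)
    show "poly (pCons 0 (central_poly m)) s = (\<Prod>i=1..2*m+1. real m + 1 + s - real i)" for s
      unfolding add.commute[of "real m + 1" s] prod_symmetric by (simp add: poly_central_poly)
  qed (use assms in simp)
  then show ?thesis
    by (simp add: central_poly_def coeff_pcompose_square)
qed

text \<open>
  For odd order there is one root fewer than in the symmetric product of index \<open>k + 1\<close> and one more,
  \<open>s = k + 1\<close>, than in that of index \<open>k\<close>. The polynomial below is \<open>s (s - (k + 1))\<close> times
  \<^term>\<open>central_poly k\<close>.
\<close>

lemma gen_bernpoly_odd_order:
  assumes "j \<le> 2 * Suc k"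
  shows "gen_bernpoly (2 * Suc k + 1) (2 * Suc k - j) (real (Suc k))
    = fact (2 * Suc k - j) * fact j / fact (2 * Suc k)
        * coeff (pCons 0 (pCons 0 (central_poly k) - smult (real (Suc k)) (central_poly k))) j"
proof -
  have "gen_bernpoly (Suc (2 * Suc k)) (2 * Suc k - j) (real (Suc k))
    = fact (2 * Suc k - j) * fact j / fact (2 * Suc k)
        * coeff (pCons 0 (pCons 0 (central_poly k) - smult (real (Suc k)) (central_poly k))) j"
  proof (rule gen_bernpoly_below_order[OF assms])
    fix s
    have "(\<Prod>i=1..2 * Suc k. real (Suc k) + s - real i)
      = (\<Prod>i=1..2*k+1. s + (real k + 1) - real i) * (s - real (Suc k))"
      by (simp add: algebra_simps)
    also have "\<dots> = poly (pCons 0 (pCons 0 (central_poly k)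
        - smult (real (Suc k)) (central_poly k))) s"
      unfolding prod_symmetric poly_central_poly[symmetric] by (simp add: algebra_simps)
    finally show "poly (pCons 0 (pCons 0 (central_poly k)
        - smult (real (Suc k)) (central_poly k))) s
      = (\<Prod>i=1..2 * Suc k. real (Suc k) + s - real i)" ..
  qed
  then show ?thesis
    by simp
qed

text \<open>
  As \<^term>\<open>central_poly k\<close> is even, in \<open>s (s - (k + 1))\<close> only the term \<open>s^2\<close> contributes to even
  exponents of \<open>s\<close>.
\<close>

lemma gen_bernpoly_odd_order_even_index:
  assumes "i \<le> k"
  shows "gen_bernpoly (2 * Suc k + 1) (2 * Suc k - 2 * Suc i) (real (Suc k))
    = fact (2 * Suc k - 2 * Suc i) * fact (2 * Suc i) / fact (2 * Suc k)
        * coeff (squares_poly k) i"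
  by (subst gen_bernpoly_odd_order)
     (use assms in \<open>simp_all add: central_poly_def coeff_pcompose_square\<close>)

theorem proposition4p4:
  shows
    "(\<forall>m::nat. gen_bernpoly (2*m+2) (2*m) (real m + 1)
        = (-1) ^ m * (fact m)^2 / (2 * real m + 1))
   \<and> (\<forall>m\<ge>1. gen_bernpoly (2*m+2) (2*m-2) (real m + 1)
        = (-1) ^ (m+1) * fact (2*m-2) / fact (2*m+1) * (fact m)^2 * 6 * gen_harmonic 2 m)
   \<and> (\<forall>m\<ge>2. gen_bernpoly (2*m+2) (2*m-4) (real m + 1)
        = (-1) ^ m * fact 5 * fact (2*m-4) / (2 * fact (2*m+1)) * (fact m)^2
            * ((gen_harmonic 2 m)^2 - gen_harmonic 4 m))
   \<and> (\<forall>m\<ge>3. gen_bernpoly (2*m+2) (2*m-6) (real m + 1)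
        = (-1) ^ (m+1) * fact 7 * fact (2*m-6) / (6 * fact (2*m+1)) * (fact m)^2
            * ((gen_harmonic 2 m)^3 - 3 * gen_harmonic 2 m * gen_harmonic 4 m
                + 2 * gen_harmonic 6 m))
   \<and> gen_bernpoly 1 0 0 = 1
   \<and> (\<forall>m\<ge>1. gen_bernpoly (2*m+1) (2*m) (real m) = 0)
   \<and> (\<forall>m\<ge>1. gen_bernpoly (2*m+1) (2*m-2) (real m)
        = (-1) ^ (m+1) * 2 * fact (2*m-2) / fact (2*m) * (fact (m-1))^2)
   \<and> (\<forall>m\<ge>2. gen_bernpoly (2*m+1) (2*m-4) (real m)
        = (-1) ^ m * fact 4 * fact (2*m-4) / fact (2*m) * (fact (m-1))^2
            * gen_harmonic 2 (m-1))
   \<and> (\<forall>m\<ge>3. gen_bernpoly (2*m+1) (2*m-6) (real m)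
        = (-1) ^ (m+1) * fact 6 * fact (2*m-6) / (2 * fact (2*m)) * (fact (m-1))^2
            * ((gen_harmonic 2 (m-1))^2 - gen_harmonic 4 (m-1)))"
proof (intro conjI allI impI)
  fix m :: nat
  show "gen_bernpoly (2*m+2) (2*m) (real m + 1) = (-1) ^ m * (fact m)^2 / (2 * real m + 1)"
    using gen_bernpoly_even_order[of 0 m]
    by (simp add: coeff_squares_poly add_ac)
  show "gen_bernpoly (2*m+2) (2*m-2) (real m + 1)
      = (-1) ^ (m+1) * fact (2*m-2) / fact (2*m+1) * (fact m)^2 * 6 * gen_harmonic 2 m"
    if "m \<ge> 1"
    using gen_bernpoly_even_order[of 1 m] that
    unfolding coeff_squares_poly by (simp add: fact_numeral)
  show "gen_bernpoly (2*m+2) (2*m-4) (real m + 1)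
      = (-1) ^ m * fact 5 * fact (2*m-4) / (2 * fact (2*m+1)) * (fact m)^2
          * ((gen_harmonic 2 m)^2 - gen_harmonic 4 m)"
    if "m \<ge> 2"
    using gen_bernpoly_even_order[of 2 m] that
    unfolding coeff_squares_poly by (simp add: fact_numeral)
  show "gen_bernpoly (2*m+2) (2*m-6) (real m + 1)
      = (-1) ^ (m+1) * fact 7 * fact (2*m-6) / (6 * fact (2*m+1)) * (fact m)^2
          * ((gen_harmonic 2 m)^3 - 3 * gen_harmonic 2 m * gen_harmonic 4 m
              + 2 * gen_harmonic 6 m)"
    if "m \<ge> 3"
    using gen_bernpoly_even_order[of 3 m] that
    unfolding coeff_squares_poly by (simp add: fact_numeral)
next
  show "gen_bernpoly 1 0 0 = 1"
    using gen_bern_fps_diagonal[of 0 0] by (simp add: gen_bern_fps_nth)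
next
  fix m :: nat
  \<comment> \<open>The odd-order lemmas are stated for \<open>k = m - 1\<close>.\<close>
  have pred: "\<exists>k. m = Suc k" if "m \<ge> 1"
    using that by (cases m) auto
  show "gen_bernpoly (2*m+1) (2*m) (real m) = 0" if "m \<ge> 1"
    using pred[OF that] gen_bernpoly_odd_order[of 0 "m - 1"] by auto
  show "gen_bernpoly (2*m+1) (2*m-2) (real m)
      = (-1) ^ (m+1) * 2 * fact (2*m-2) / fact (2*m) * (fact (m-1))^2" if "m \<ge> 1"
    using pred[OF that] gen_bernpoly_odd_order_even_index[of 0 "m - 1"]
    unfolding coeff_squares_poly by (auto simp: fact_numeral)
  show "gen_bernpoly (2*m+1) (2*m-4) (real m)
      = (-1) ^ m * fact 4 * fact (2*m-4) / fact (2*m) * (fact (m-1))^2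
          * gen_harmonic 2 (m-1)" if "m \<ge> 2"
    using pred that gen_bernpoly_odd_order_even_index[of 1 "m - 1"]
    unfolding coeff_squares_poly by (auto simp: fact_numeral)
  show "gen_bernpoly (2*m+1) (2*m-6) (real m)
      = (-1) ^ (m+1) * fact 6 * fact (2*m-6) / (2 * fact (2*m)) * (fact (m-1))^2
          * ((gen_harmonic 2 (m-1))^2 - gen_harmonic 4 (m-1))" if "m \<ge> 3"
    using pred that gen_bernpoly_odd_order_even_index[of 2 "m - 1"]
    unfolding coeff_squares_poly by (auto simp: fact_numeral)
qed

end
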